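(* Let $L$ be a nontrivial simple geometric lattice. Then exactly one of the following two possibilities can occur: (a) $L$ is modular and $\operatorname{Dim}L\cong\mathbb{Z}^+$. (b) $L$ is not modular and $\operatorname{Dim}L\cong\mathbf{2}$.
   Context: For a lattice $L$, the dimension monoid $\operatorname{Dim}L$ is the commutative monoid defined by generators $\Delta(a,b)$ (for $a\leq b$ in $L$) and the relations: (D0) $\Delta(a,a)=0$ for all $a\in L$; (D1) $\Delta(a,c)=\Delta(a,b)+\Delta(b,c)$ for all $a\leq b\leq c$ in $L$; (D2) $\Delta(a,a\vee b)=\Delta(a\wedge b,b)$ for all $a,b\in L$. A lattice $L$ is geometric if it is algebraic (complete, and every element is a supremum of compact elements), its compact elements are exactly the finite suprema of atoms, and it is (upper) semimodular. $L$ is not assumed to be of finite height. A nontrivial (more than one element) lattice is simple if its only congruences are the identity and the full relation. $\mathbb{Z}^+$ is the additive monoid $\{0,1,2,\ldots\}$, and $\mathbf{2}=\{0,\infty\}$ is the two-element semilattice, viewed as a commutative monoid (so $\infty+\infty=\infty$). Isomorphisms are monoid isomorphisms. *)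

theory Defs
  imports
    "HOL-Algebra.Group"
    "HOL-Library.Multiset"
    "HOL-Library.Extended_Nat"
begin

text \<open>
  A lattice is a type of class \<open>lattice\<close>; properties of the lattice take the type as an
  argument of type \<open>'a itself\<close>.
\<close>

subsection \<open>Geometric lattices\<close>

definition nontrivial_lattice :: "'a::lattice itself \<Rightarrow> bool"
  where "nontrivial_lattice _ \<longleftrightarrow> (\<exists>x y::'a. x \<noteq> y)"

definition modular_lattice :: "'a::lattice itself \<Rightarrow> bool"
  where "modular_lattice _ \<longleftrightarrow>
    (\<forall>a b c::'a. a \<le> c \<longrightarrow> sup a (inf b c) = inf (sup a b) c)"

definition lattice_congruence :: "('a::lattice \<times> 'a) set \<Rightarrow> bool"
  where "lattice_congruence \<theta> \<longleftrightarrow> equiv UNIV \<theta> \<and>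
    (\<forall>a a' b b'. (a, a') \<in> \<theta> \<longrightarrow> (b, b') \<in> \<theta> \<longrightarrow>
       (sup a b, sup a' b') \<in> \<theta> \<and> (inf a b, inf a' b') \<in> \<theta>)"

definition simple_lattice :: "'a::lattice itself \<Rightarrow> bool"
  where "simple_lattice _ \<longleftrightarrow> nontrivial_lattice TYPE('a) \<and>
    (\<forall>\<theta> :: ('a \<times> 'a) set. lattice_congruence \<theta> \<longrightarrow> \<theta> = Id \<or> \<theta> = UNIV)"

definition compact_element :: "'a::complete_lattice \<Rightarrow> bool"
  where "compact_element c \<longleftrightarrow>
    (\<forall>A. c \<le> Sup A \<longrightarrow> (\<exists>B. finite B \<and> B \<subseteq> A \<and> c \<le> Sup B))"

text \<open>Completeness is part of the type class.\<close>

definition algebraic_lattice :: "'a::complete_lattice itself \<Rightarrow> bool"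
  where "algebraic_lattice _ \<longleftrightarrow>
    (\<forall>x::'a. \<exists>K. (\<forall>k\<in>K. compact_element k) \<and> x = Sup K)"

definition covered_by :: "'a::order \<Rightarrow> 'a \<Rightarrow> bool"
  where "covered_by a b \<longleftrightarrow> a < b \<and> \<not> (\<exists>x. a < x \<and> x < b)"

definition atom :: "'a::order_bot \<Rightarrow> bool"
  where "atom p \<longleftrightarrow> covered_by bot p"

definition semimodular_lattice :: "'a::lattice itself \<Rightarrow> bool"
  where "semimodular_lattice _ \<longleftrightarrow>
    (\<forall>a b::'a. covered_by (inf a b) a \<longrightarrow> covered_by b (sup a b))"

text \<open>The empty supremum is included, so that \<open>bot\<close> counts as a finite supremum of atoms.\<close>

definition geometric_lattice :: "'a::complete_lattice itself \<Rightarrow> bool"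
  where "geometric_lattice _ \<longleftrightarrow>
    algebraic_lattice TYPE('a) \<and>
    (\<forall>x::'a. compact_element x \<longleftrightarrow> (\<exists>F. finite F \<and> (\<forall>p\<in>F. atom p) \<and> x = Sup F)) \<and>
    semimodular_lattice TYPE('a)"


subsection \<open>The dimension monoid\<close>

text \<open>
  The free commutative monoid on the symbols \<open>\<Delta>(a,b)\<close> with \<open>a \<le> b\<close> consists of the finite
  multisets of such pairs.  The dimension monoid is its quotient by the least monoid
  congruence containing the relations (D0), (D1), (D2).
\<close>

definition formal_sums :: "('a::lattice \<times> 'a) multiset set"
  where "formal_sums = {M. \<forall>(a, b) \<in># M. a \<le> b}"

inductive dim_eq :: "('a::lattice \<times> 'a) multiset \<Rightarrow> ('a \<times> 'a) multiset \<Rightarrow> bool" where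
  D0: "dim_eq {#(a, a)#} {#}"
| D1: "a \<le> b \<Longrightarrow> b \<le> c \<Longrightarrow> dim_eq {#(a, c)#} {#(a, b), (b, c)#}"
| D2: "dim_eq {#(a, sup a b)#} {#(inf a b, b)#}"
| refl: "M \<in> formal_sums \<Longrightarrow> dim_eq M M"
| sym: "dim_eq M N \<Longrightarrow> dim_eq N M"
| trans: "dim_eq M N \<Longrightarrow> dim_eq N P \<Longrightarrow> dim_eq M P"
| add: "dim_eq M N \<Longrightarrow> P \<in> formal_sums \<Longrightarrow> dim_eq (M + P) (N + P)"

definition dim_class :: "('a::lattice \<times> 'a) multiset \<Rightarrow> ('a \<times> 'a) multiset set"
  where "dim_class M = {N. dim_eq M N}"

definition Dim :: "'a::lattice itself \<Rightarrow> ('a \<times> 'a) multiset set monoid"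
  where "Dim _ =
    \<lparr>carrier = dim_class ` formal_sums,
     monoid.mult = (\<lambda>X Y. \<Union>M\<in>X. \<Union>N\<in>Y. dim_class (M + N)),
     monoid.one = dim_class {#}\<rparr>"

lemma dim_eq_formal_sums: "dim_eq M N \<Longrightarrow> M \<in> formal_sums \<and> N \<in> formal_sums"
  by (induction rule: dim_eq.induct) (auto simp: formal_sums_def intro: order_trans)

lemma dim_eq_add:
  assumes "dim_eq M M'" "dim_eq N N'"
  shows "dim_eq (M + N) (M' + N')"
proof -
  have "dim_eq (M + N) (M' + N)"
    using assms by (intro dim_eq.add) (auto dest: dim_eq_formal_sums)
  moreover have "dim_eq (N + M') (N' + M')"
    using assms by (intro dim_eq.add) (auto dest: dim_eq_formal_sums)
  ultimately show ?thesis
    by (metis dim_eq.trans add.commute)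
qed

lemma dim_class_eq_iff: "M \<in> formal_sums \<Longrightarrow> dim_class M = dim_class N \<longleftrightarrow> dim_eq M N"
  unfolding dim_class_def by (blast intro: dim_eq.refl dim_eq.sym dim_eq.trans)

lemma Dim_mult:
  assumes "M \<in> formal_sums" "N \<in> formal_sums"
  shows "dim_class M \<otimes>\<^bsub>Dim TYPE('a::lattice)\<^esub> dim_class N = dim_class (M + N)"
proof -
  have "dim_class (M' + N') = dim_class (M + N)" if "dim_eq M M'" "dim_eq N N'" for M' N'
    using dim_eq_add[OF that] dim_eq_formal_sums dim_class_eq_iff by blast
  moreover have "M \<in> dim_class M" "N \<in> dim_class N"
    using assms by (auto simp: dim_class_def intro: dim_eq.refl)
  ultimately have "(\<Union>M'\<in>dim_class M. \<Union>N'\<in>dim_class N. dim_class (M' + N')) = dim_class (M + N)"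
    unfolding dim_class_def by blast
  then show ?thesis
    by (simp add: Dim_def)
qed

lemma comm_monoid_Dim: "comm_monoid (Dim TYPE('a::lattice))"
proof -
  have car: "carrier (Dim TYPE('a)) = dim_class ` formal_sums"
    and one: "\<one>\<^bsub>Dim TYPE('a)\<^esub> = dim_class {#}"
    by (simp_all add: Dim_def)
  have zero: "{#} \<in> (formal_sums :: ('a \<times> 'a) multiset set)"
    by (simp add: formal_sums_def)
  have plus: "M + N \<in> formal_sums"
    if "M \<in> formal_sums" "N \<in> formal_sums" for M N :: "('a \<times> 'a) multiset"
    using that by (auto simp: formal_sums_def)
  show ?thesis
    by (rule comm_monoidI)
      (auto simp: car one Dim_mult zero plus add_ac intro!: imageI)
qed

text \<open>Maps out of the dimension monoid are the maps on intervals respecting (D0), (D1), (D2).\<close>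

lemma dim_eq_sum:
  fixes f :: "'a::lattice \<Rightarrow> 'a \<Rightarrow> 'm::comm_monoid_add"
  assumes "dim_eq M N"
    and "\<And>a. f a a = 0"
    and "\<And>a b c. a \<le> b \<Longrightarrow> b \<le> c \<Longrightarrow> f a c = f a b + f b c"
    and "\<And>a b. f a (sup a b) = f (inf a b) b"
  shows "(\<Sum>(a, b)\<in>#M. f a b) = (\<Sum>(a, b)\<in>#N. f a b)"
  using assms(1)
proof (induction rule: dim_eq.induct)
  case (D1 a b c)
  then show ?case using assms(3)[of a b c] by simp
qed (simp_all add: assms(2,4))


subsection \<open>The two target monoids\<close>

definition nat_monoid :: "nat monoid"
  where "nat_monoid = \<lparr>carrier = UNIV, monoid.mult = (+), monoid.one = 0\<rparr>"

definition two_monoid :: "enat monoid"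
  where "two_monoid = \<lparr>carrier = {0, \<infinity>}, monoid.mult = (+), monoid.one = 0\<rparr>"

text \<open>
  Below, \<open>\<cong>\<close> is \<open>is_iso\<close>: a multiplicative bijection of carriers.  Between monoids such a map
  preserves the unit.
\<close>

lemma iso_monoid_one:
  assumes "monoid G" "monoid H" "h \<in> iso G H"
  shows "h \<one>\<^bsub>G\<^esub> = \<one>\<^bsub>H\<^esub>"
proof -
  interpret G: monoid G by fact
  interpret H: monoid H by fact
  have hom: "h \<in> hom G H" and surj: "h ` carrier G = carrier H"
    using assms(3) by (auto simp: iso_iff)
  obtain x where x: "x \<in> carrier G" "h x = \<one>\<^bsub>H\<^esub>"
    using surj H.one_closed by (metis imageE)
  have "h \<one>\<^bsub>G\<^esub> = h \<one>\<^bsub>G\<^esub> \<otimes>\<^bsub>H\<^esub> h x"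
    using hom x by (simp add: hom_in_carrier)
  also have "\<dots> = h (\<one>\<^bsub>G\<^esub> \<otimes>\<^bsub>G\<^esub> x)"
    using hom_mult[OF hom G.one_closed x(1)] by simp
  finally show ?thesis using x by simp
qed

end

theory Submission
  imports Defs
begin

text \<open>
  Write \<open>\<Delta>(x,y)\<close> for the class of the interval \<open>[x,y]\<close> in \<open>Dim L\<close>.  Everything
  follows by feeding suitable congruences to simplicity.

  First, all covers \<open>x \<prec> y\<close> have the same class \<open>e\<close>.  If \<open>p\<close> is an atom below \<open>y\<close>
  but not below \<open>x\<close>, then \<open>y = x \<or> p\<close> and (D2) gives \<open>\<Delta>(x,y) = \<Delta>(0,p)\<close>; hence perspective
  atoms have equal classes.  By the exchange property, an atom below a join of atoms is already
  below the join of those among them that are perspective to it.  Therefore ``the same atoms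
  outside a given class lie below \<open>a\<close> and below \<open>b\<close>'' is a congruence, and simplicity leaves
  room for one class of atoms only (\<open>simple_geometric_Delta_covered_by\<close>).

  Second, in a simple lattice a property of intervals that survives concatenation and
  translation by joins and meets holds for every interval as soon as it holds for one proper
  interval (\<open>simple_lattice_interval_property\<close>).

  If \<open>L\<close> is modular, joins and meets take covers to covers or equalities, so ``being
  spanned by a finite chain of covers'' is such a property.  All intervals thus have finite
  length, \<open>\<Delta>(x,y)\<close> is that many copies of \<open>e\<close>, and length itself is a dimension function with
  values in the natural numbers (\<open>Dim_iso_nat\<close>).

  If \<open>L\<close> is not modular, some cover \<open>x \<prec> y\<close> is met with an element \<open>z\<close> to a proper interval
  that is not a cover.  An interval \<open>[x \<and> z, s]\<close> of length two below \<open>y \<and> z\<close> then transposes up to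
  \<open>[x,y]\<close>, so \<open>e = 2e\<close> (\<open>nonmodular_Delta_covered_by_idempotent\<close>).  Intervals may have infinite
  length here, so this does not settle \<open>\<Delta>(x,y)\<close> in general.  But given \<open>2e = e\<close>, the property
  ``every subinterval has class \<open>0\<close> or \<open>e\<close>'' again survives concatenation and translation; the
  only obstruction is a pentagon, and its critical interval is absorbed by one of its transposed
  sides.  So all proper intervals have class \<open>e\<close>, which is nonzero because sending
  proper intervals to \<open>\<infinity>\<close> is a dimension function (\<open>Dim_iso_two\<close>).
\<close>

section \<open>The dimension monoid as a type\<close>

text \<open>
  With the dimension monoid as a type of class \<^class>\<open>comm_monoid_add\<close>, identities between
  dimensions become ordinary additive calculations.
\<close>

quotient_type (overloaded) 'a dimension = "('a::lattice \<times> 'a) multiset" / partial: dim_eq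
proof (rule part_equivpI)
  show "\<exists>M :: ('a \<times> 'a) multiset. dim_eq M M"
    using dim_eq.D0 dim_eq.refl dim_eq_formal_sums by blast
  show "symp (dim_eq :: ('a \<times> 'a) multiset \<Rightarrow> _)"
    by (rule sympI) (rule dim_eq.sym)
  show "transp (dim_eq :: ('a \<times> 'a) multiset \<Rightarrow> _)"
    by (rule transpI) (rule dim_eq.trans)
qed

lemma empty_in_formal_sums: "{#} \<in> formal_sums"
  by (simp add: formal_sums_def)

lemma add_mset_in_formal_sums_iff:
  "add_mset (a, b) M \<in> formal_sums \<longleftrightarrow> a \<le> b \<and> M \<in> formal_sums"
  by (auto simp: formal_sums_def)

instantiation dimension :: (lattice) comm_monoid_add
begin

lift_definition zero_dimension :: "'a dimension" is "{#}"
  by (rule dim_eq.refl[OF empty_in_formal_sums])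

lift_definition plus_dimension :: "'a dimension \<Rightarrow> 'a dimension \<Rightarrow> 'a dimension" is "(+)"
  by (rule dim_eq_add)

instance
proof
  fix x y z :: "'a dimension"
  show "x + y + z = x + (y + z)"
    by transfer (simp add: add.assoc dim_eq_add)
  show "x + y = y + x"
    by transfer (simp add: add.commute dim_eq_add)
  show "0 + x = x"
    by transfer simp
qed

end

text \<open>
  Replacing \<open>a\<close> by \<open>inf a b\<close> makes the function total; it changes nothing when \<open>a \<le> b\<close>, and (D2)
  then reads \<open>Delta a (sup a b) = Delta a b\<close>.
\<close>

lift_definition Delta :: "'a::lattice \<Rightarrow> 'a \<Rightarrow> 'a dimension" is "\<lambda>a b. {#(inf a b, b)#}"
  by (rule dim_eq.refl) (simp add: formal_sums_def)

lemma Delta_inf: "Delta (inf a b) b = Delta a b"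
  by transfer (auto intro!: dim_eq.refl simp: formal_sums_def)

lemma Delta_self [simp]: "Delta a a = 0"
  by transfer (simp add: dim_eq.D0)

lemma Delta_split: "a \<le> b \<Longrightarrow> b \<le> c \<Longrightarrow> Delta a c = Delta a b + Delta b c"
  apply transfer
  subgoal for a b c
    using dim_eq.D1[of a b c]
    by (simp add: inf.absorb1 order_trans[of a b c] add_mset_commute[of "(b, c)"])
  done

lemma Delta_sup: "Delta a (sup a b) = Delta a b"
  by transfer (simp add: dim_eq.D2 inf.absorb1)

lemma abs_dimension_eq_sum:
  "M \<in> formal_sums \<Longrightarrow> abs_dimension M = (\<Sum>(a, b)\<in>#M. Delta a b)"
proof (induction M)
  case empty
  then show ?case by (simp add: zero_dimension_def)
next
  case (add x M)
  obtain a b where x: "x = (a, b)" by (cases x)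
  then have ab: "a \<le> b" and M: "M \<in> formal_sums"
    using add.prems by (auto simp: add_mset_in_formal_sums_iff)
  have "{#(a, b)#} \<in> formal_sums"
    using ab by (simp add: formal_sums_def)
  then have "abs_dimension ({#(a, b)#} + M) = abs_dimension {#(a, b)#} + abs_dimension M"
    using M by (simp add: plus_dimension.abs_eq dim_eq.refl)
  moreover have "abs_dimension {#(a, b)#} = Delta a b"
    using ab by (simp add: Delta.abs_eq inf.absorb1)
  ultimately show ?case
    using add.IH[OF M] x by simp
qed

text \<open>
  A dimension function \<open>f\<close> induces a homomorphism out of \<open>Dim L\<close>.  A homomorphism \<open>g\<close> back into
  \<open>Dim L\<close> that recovers every generator is a left inverse, which makes the induced map injective.
\<close>

lemma Dim_iso_if_dimension_function:
  fixes f :: "'a::lattice \<Rightarrow> 'a \<Rightarrow> 'm::comm_monoid_add" and g :: "'m \<Rightarrow> 'a dimension"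
  assumes f0: "\<And>a. f a a = 0"
    and f1: "\<And>a b c. a \<le> b \<Longrightarrow> b \<le> c \<Longrightarrow> f a c = f a b + f b c"
    and f2: "\<And>a b. f a (sup a b) = f (inf a b) b"
    and g0: "g 0 = 0" and g_add: "\<And>x y. g (x + y) = g x + g y"
    and gf: "\<And>a b. a \<le> b \<Longrightarrow> g (f a b) = Delta a b"
    and carrier: "carrier H = (\<lambda>M. \<Sum>(a, b)\<in>#M. f a b) ` formal_sums"
    and mult: "monoid.mult H = (+)"
  shows "Dim TYPE('a) \<cong> H"
proof -
  define S where "S M = (\<Sum>(a, b)\<in>#M. f a b)" for M
  have S_add: "S (M + N) = S M + S N" for M N
    by (simp add: S_def)
  have S_resp: "S M = S N" if "dim_eq M N" for M N
    unfolding S_def by (rule dim_eq_sum[OF that f0 f1 f2])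
  have g_S: "g (S M) = abs_dimension M" if "M \<in> formal_sums" for M
    unfolding abs_dimension_eq_sum[OF that] using that
  proof (induction M)
    case (add x M)
    then show ?case
      by (cases x) (simp add: S_def g_add gf add_mset_in_formal_sums_iff)
  qed (simp add: S_def g0)
  have S_inj: "dim_eq M N" if "M \<in> formal_sums" "N \<in> formal_sums" "S M = S N" for M N
  proof -
    have "abs_dimension M = abs_dimension N"
      using g_S[OF that(1)] g_S[OF that(2)] that(3) by simp
    then show ?thesis
      using Quotient_rel[OF Quotient_dimension, of M N] that(1,2) dim_eq.refl by blast
  qed
  define h where "h X = S (SOME M. M \<in> X)" for X
  have h: "h (dim_class M) = S M" if "M \<in> formal_sums" for M
  proof -
    have "M \<in> dim_class M"
      using that by (simp add: dim_class_def dim_eq.refl)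
    then have "(SOME N. N \<in> dim_class M) \<in> dim_class M"
      by (rule someI[where P = "\<lambda>N. N \<in> dim_class M"])
    then have "dim_eq M (SOME N. N \<in> dim_class M)"
      unfolding dim_class_def by (rule CollectD)
    then show ?thesis
      unfolding h_def by (rule S_resp[symmetric])
  qed
  have carrier_Dim: "carrier (Dim TYPE('a)) = dim_class ` formal_sums"
    by (simp add: Dim_def)
  have plus: "M + N \<in> formal_sums"
    if "M \<in> formal_sums" "N \<in> formal_sums" for M N :: "('a \<times> 'a) multiset"
    using that by (auto simp: formal_sums_def)
  have "h \<in> hom (Dim TYPE('a)) H"
    unfolding hom_def carrier_Dim carrier
    by (auto simp: h Dim_mult plus S_add mult S_def[symmetric])
  moreover have "bij_betw h (carrier (Dim TYPE('a))) (carrier H)"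
    unfolding bij_betw_def
  proof
    show "inj_on h (carrier (Dim TYPE('a)))"
      unfolding carrier_Dim inj_on_def by (auto simp: h dim_class_eq_iff S_inj)
    show "h ` carrier (Dim TYPE('a)) = carrier H"
      unfolding carrier_Dim carrier image_image S_def[symmetric] by (simp add: h)
  qed
  ultimately show ?thesis
    unfolding is_iso_def iso_def by blast
qed


section \<open>Simple lattices\<close>

text \<open>
  Two elements are related when a common interval with the property contains both.  Translation
  and concatenation make this a congruence, and translation also passes the property to
  subintervals, so that the full congruence gives the property for all intervals.
\<close>

lemma simple_lattice_interval_property:
  fixes G :: "'a::lattice \<Rightarrow> 'a \<Rightarrow> bool"
  assumes simple: "simple_lattice TYPE('a)"
    and refl: "\<And>a. G a a"
    and trans: "\<And>a b c. a \<le> b \<Longrightarrow> b \<le> c \<Longrightarrow> G a b \<Longrightarrow> G b c \<Longrightarrow> G a c"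
    and join: "\<And>a b t. a \<le> b \<Longrightarrow> G a b \<Longrightarrow> G (sup a t) (sup b t)"
    and meet: "\<And>a b t. a \<le> b \<Longrightarrow> G a b \<Longrightarrow> G (inf a t) (inf b t)"
    and ab: "a < b" "G a b" and xy: "x \<le> y"
  shows "G x y"
proof -
  define \<theta> where
    "\<theta> = {(x, y). \<exists>a b. a \<le> x \<and> a \<le> y \<and> x \<le> b \<and> y \<le> b \<and> G a b}"
  have \<theta>I: "(x, y) \<in> \<theta>" if "a \<le> x" "a \<le> y" "x \<le> b" "y \<le> b" "G a b" for x y a b
    using that by (auto simp: \<theta>_def)
  have \<theta>E: "\<exists>a b. a \<le> x \<and> a \<le> y \<and> x \<le> b \<and> y \<le> b \<and> G a b" if "(x, y) \<in> \<theta>" for x y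
    using that by (auto simp: \<theta>_def)
  have "lattice_congruence \<theta>"
    unfolding lattice_congruence_def
  proof (intro conjI allI impI)
    show "equiv UNIV \<theta>"
    proof (rule equivI)
      show "refl \<theta>"
        by (rule reflI) (meson \<theta>I order_refl refl)
      show "sym \<theta>"
        by (rule symI) (metis \<theta>E \<theta>I)
      show "Relation.trans \<theta>"
      proof (rule transI)
        fix x y z assume "(x, y) \<in> \<theta>" "(y, z) \<in> \<theta>"
        then obtain a b c d where 1: "a \<le> x" "a \<le> y" "x \<le> b" "y \<le> b" "G a b"
          and 2: "c \<le> y" "c \<le> z" "y \<le> d" "z \<le> d" "G c d"
          by (meson \<theta>E)
        \<comment> \<open>The interval \<open>[a \<and> c, b \<or> d]\<close> contains \<open>x\<close> and \<open>z\<close>. Since \<open>c \<le> y \<le> b\<close> and \<open>a \<le> y \<le> d\<close>,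
          it is the concatenation of \<open>[a \<and> c, b \<and> c]\<close>, \<open>[c, d]\<close> and \<open>[a \<or> d, b \<or> d]\<close>.\<close>
        have "c \<le> b" "a \<le> d"
          using 1 2 by (meson order_trans)+
        then have "G (inf a c) c" "G d (sup b d)"
          using meet[of a b c] join[of a b d] 1 2
          by (auto simp: inf.absorb2 sup.absorb2 intro: order_trans)
        then have "G (inf a c) (sup b d)"
          by (meson trans 1 2 order_trans inf_le2 sup_ge2)
        then show "(x, z) \<in> \<theta>"
          by (rule \<theta>I[rotated -1]) (use 1 2 in \<open>auto intro: le_infI1 le_infI2 le_supI1 le_supI2\<close>)
      qed
    qed simp
  next
    fix x x' y y' assume "(x, x') \<in> \<theta>" "(y, y') \<in> \<theta>"
    then obtain a b c d where 1: "a \<le> x" "a \<le> x'" "x \<le> b" "x' \<le> b" "G a b"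
      and 2: "c \<le> y" "c \<le> y'" "y \<le> d" "y' \<le> d" "G c d"
      by (meson \<theta>E)
    have le: "a \<le> b" "c \<le> d"
      using 1 2 by (meson order_trans)+
    have "G (sup a c) (sup b c)" "G (sup b c) (sup b d)"
      using join[OF le(1) 1(5), of c] join[OF le(2) 2(5), of b] by (simp_all add: sup.commute)
    then have "G (sup a c) (sup b d)"
      using le by (meson trans sup_mono order_refl)
    then show "(sup x y, sup x' y') \<in> \<theta>"
      by (rule \<theta>I[rotated -1]) (use 1 2 in \<open>auto intro: le_supI1 le_supI2\<close>)
    have "G (inf a c) (inf b c)" "G (inf b c) (inf b d)"
      using meet[OF le(1) 1(5), of c] meet[OF le(2) 2(5), of b] by (simp_all add: inf.commute)
    then have "G (inf a c) (inf b d)"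
      using le by (meson trans inf_mono order_refl)
    then show "(inf x y, inf x' y') \<in> \<theta>"
      by (rule \<theta>I[rotated -1]) (use 1 2 in \<open>auto intro: le_infI1 le_infI2\<close>)
  qed
  moreover have "(a, b) \<in> \<theta>" "(a, b) \<notin> Id"
    using \<theta>I[of a a b b] ab by auto
  ultimately have "\<theta> = UNIV"
    using simple by (auto simp: simple_lattice_def)
  then obtain c d where cd: "c \<le> x" "c \<le> y" "x \<le> d" "y \<le> d" "G c d"
    using \<theta>E[of x y] by blast
  then have "G x d"
    using join[of c d x] by (auto simp: sup.absorb2 sup.absorb1 intro: order_trans)
  then show "G x y"
    using meet[of x d y] cd xy by (simp add: inf.absorb1 inf.absorb2)
qed


section \<open>Atoms of geometric lattices\<close>

lemma covered_by_less: "covered_by a b \<Longrightarrow> a < b"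
  by (simp add: covered_by_def)

lemma covered_by_between: "covered_by a b \<Longrightarrow> a \<le> x \<Longrightarrow> x \<le> b \<Longrightarrow> x = a \<or> x = b"
  by (auto simp: covered_by_def less_le)

lemma covered_by_inf_cases:
  fixes a b x :: "'a::lattice"
  assumes "covered_by a b" "a \<le> x"
  shows "inf b x = a \<or> b \<le> x"
proof -
  have "inf b x = a \<or> inf b x = b"
    using covered_by_between[OF assms(1), of "inf b x"] covered_by_less[OF assms(1)] assms(2)
    by (simp add: less_imp_le)
  then show ?thesis
    by (auto simp: le_iff_inf)
qed

lemma inf_atom_eq_bot:
  fixes p :: "'a::bounded_lattice_bot"
  assumes "atom p" "\<not> p \<le> x"
  shows "inf x p = bot"
  using assms covered_by_inf_cases[of bot p x] by (auto simp: atom_def inf.commute)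

lemma geometric_exists_atom_below:
  fixes x y :: "'a::complete_lattice"
  assumes geo: "geometric_lattice TYPE('a)" and "\<not> x \<le> y"
  obtains p where "atom p" "p \<le> x" "\<not> p \<le> y"
proof -
  obtain K where K: "\<forall>k\<in>K. compact_element k" "x = Sup K"
    using geo unfolding geometric_lattice_def algebraic_lattice_def by metis
  then obtain k where k: "k \<in> K" "\<not> k \<le> y"
    using assms(2) by (auto simp: Sup_le_iff)
  then obtain F where F: "\<forall>p\<in>F. atom p" "k = Sup F"
    using geo K unfolding geometric_lattice_def by metis
  then obtain p where "p \<in> F" "\<not> p \<le> y"
    using k by (auto simp: Sup_le_iff)
  moreover have "p \<le> x"
    using \<open>p \<in> F\<close> F k K by (metis Sup_upper order_trans)
  ultimately show thesis
    using that F by blast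
qed

lemma eq_Sup_atoms:
  fixes x :: "'a::complete_lattice"
  assumes "geometric_lattice TYPE('a)"
  shows "x = Sup {p. atom p \<and> p \<le> x}"
proof (rule antisym)
  show "x \<le> Sup {p. atom p \<and> p \<le> x}"
    using geometric_exists_atom_below[OF assms, of x "Sup {p. atom p \<and> p \<le> x}"]
    by (metis (mono_tags, lifting) Sup_upper mem_Collect_eq)
qed (auto intro: Sup_least)

lemma atom_compact:
  fixes p :: "'a::complete_lattice"
  assumes "geometric_lattice TYPE('a)" "atom p"
  shows "compact_element p"
  using assms unfolding geometric_lattice_def
  by (auto intro!: exI[of _ "{p}"])

text \<open>
  The interval \<open>[a, b]\<close> transposes up to \<open>[sup a t, sup b t]\<close> unless the latter collapses; this is
  the form of semimodularity that is closed under iteration along chains.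
\<close>

lemma covered_by_sup_cases:
  fixes a b t :: "'a::complete_lattice"
  assumes "geometric_lattice TYPE('a)" "covered_by a b"
  shows "sup a t = sup b t \<or> covered_by (sup a t) (sup b t)"
proof -
  consider "inf b (sup a t) = a" | "b \<le> sup a t"
    using covered_by_inf_cases[OF assms(2), of "sup a t"] by auto
  then show ?thesis
  proof cases
    case 1
    have "sup b (sup a t) = sup b t"
      using covered_by_less[OF assms(2)] by (simp add: sup.assoc[symmetric] sup.absorb1)
    moreover have "covered_by (inf b (sup a t)) b"
      using 1 assms(2) by simp
    ultimately show ?thesis
      using assms(1) unfolding geometric_lattice_def semimodular_lattice_def by metis
  next
    case 2
    moreover have "a \<le> sup b t"
      using covered_by_less[OF assms(2)] by (simp add: le_supI1)
    ultimately show ?thesis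
      by (auto intro!: antisym)
  qed
qed

lemma covered_by_sup_atom:
  fixes p x :: "'a::complete_lattice"
  assumes "geometric_lattice TYPE('a)" "atom p" "\<not> p \<le> x"
  shows "covered_by x (sup x p)"
proof -
  have "sup bot x \<noteq> sup p x"
    using assms(3) by (simp add: sup.absorb_iff2)
  then show ?thesis
    using covered_by_sup_cases[OF assms(1), of bot p x] assms(2) by (simp add: atom_def sup.commute)
qed

lemma atom_exchange:
  fixes p q x :: "'a::complete_lattice"
  assumes "geometric_lattice TYPE('a)" "atom p" "atom q" "p \<le> sup x q" "\<not> p \<le> x"
  shows "sup x p = sup x q"
proof -
  have "\<not> q \<le> x"
    using assms(4,5) by (metis sup.absorb1)
  then have "covered_by x (sup x q)"
    using covered_by_sup_atom assms by blast
  then show ?thesis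
    using covered_by_between[of x "sup x q" "sup x p"] assms(4,5) by (metis le_supI sup_ge1 sup_ge2)
qed

lemma covered_by_eq_sup_atom:
  fixes x y p :: "'a::complete_lattice"
  assumes "covered_by x y" "p \<le> y" "\<not> p \<le> x"
  shows "y = sup x p"
  using covered_by_between[OF assms(1), of "sup x p"] covered_by_less[OF assms(1)] assms(2,3)
  by (metis le_supI less_imp_le sup_ge1 sup_ge2)


section \<open>Perspectivity of atoms\<close>

text \<open>
  Let \<open>q\<close> lie below the join of a finite set of atoms, of least possible size.  Omitting one
  atom \<open>p\<close> of that set leaves a join \<open>x\<close> not above \<open>q\<close>, and exchange gives \<open>sup x p = sup x q\<close>.
  So \<open>p\<close> and \<open>q\<close> are perspective, and an invariant of perspectivity takes the same value on both.
\<close>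

lemma atom_le_Sup_same_colour:
  fixes q :: "'a::complete_lattice" and colour :: "'a \<Rightarrow> 'b"
  assumes geo: "geometric_lattice TYPE('a)"
    and colour: "\<And>p q x. atom p \<Longrightarrow> atom q \<Longrightarrow> \<not> p \<le> x \<Longrightarrow> \<not> q \<le> x \<Longrightarrow> sup x p = sup x q \<Longrightarrow>
      colour p = colour q"
    and q: "atom q" "q \<le> Sup A" and A: "\<And>p. p \<in> A \<Longrightarrow> atom p"
  shows "q \<le> Sup {p \<in> A. colour p = colour q}"
proof -
  have "\<exists>B. finite B \<and> B \<subseteq> A \<and> q \<le> Sup B"
    using atom_compact[OF geo q(1)] q(2) by (auto simp: compact_element_def)
  then obtain B where B: "finite B" "B \<subseteq> A" "q \<le> Sup B"
    and min: "\<And>C. finite C \<Longrightarrow> C \<subseteq> A \<Longrightarrow> q \<le> Sup C \<Longrightarrow> card B \<le> card C"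
    using ex_has_least_nat[of "\<lambda>B. finite B \<and> B \<subseteq> A \<and> q \<le> Sup B" _ card] by meson
  have "colour p = colour q" if p: "p \<in> B" for p
  proof -
    define x where "x = Sup (B - {p})"
    have "q \<le> sup x p"
      using B(3) p by (metis Sup_insert insert_Diff sup.commute x_def)
    moreover have "\<not> q \<le> x"
      using min[of "B - {p}"] B p card_Diff1_less[OF B(1) p] by (auto simp: x_def)
    ultimately have "sup x q = sup x p" "\<not> p \<le> x"
      using atom_exchange[OF geo q(1) A, of p x] p B(2) by (auto simp: sup.absorb1)
    then show ?thesis
      using colour[of p q x] \<open>\<not> q \<le> x\<close> q A p B(2) by auto
  qed
  then show ?thesis
    using B by (intro order_trans[OF B(3)] Sup_subset_mono) auto
qed

text \<open>
  In matroid terms, a simple geometric lattice is connected.  Relate \<open>a\<close> and \<open>b\<close> when the same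
  atoms of a colour other than that of \<open>p\<close> lie below them.  Compatibility with joins is the
  previous lemma.  The relation identifies \<open>bot\<close> with \<open>p\<close>, so it is full, and no atom of another
  colour can exist.
\<close>

lemma simple_geometric_atoms_same_colour:
  fixes p q :: "'a::complete_lattice" and colour :: "'a \<Rightarrow> 'b"
  assumes geo: "geometric_lattice TYPE('a)" and simple: "simple_lattice TYPE('a)"
    and colour: "\<And>p q x. atom p \<Longrightarrow> atom q \<Longrightarrow> \<not> p \<le> x \<Longrightarrow> \<not> q \<le> x \<Longrightarrow> sup x p = sup x q \<Longrightarrow>
      colour p = colour q"
    and p: "atom p" and q: "atom q"
  shows "colour p = colour q"
proof (rule ccontr)
  assume neq: "colour p \<noteq> colour q"
  define \<theta> where
    "\<theta> = {(a, b). \<forall>r. atom r \<longrightarrow> colour r \<noteq> colour p \<longrightarrow> (r \<le> a \<longleftrightarrow> r \<le> b)}"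
  have le_sup: "r \<le> sup b b'"
    if r: "atom r" "colour r \<noteq> colour p" and "r \<le> sup a a'"
      and \<theta>: "(a, b) \<in> \<theta>" "(a', b') \<in> \<theta>" for a a' b b' r
  proof -
    define A where "A = {s. atom s \<and> (s \<le> a \<or> s \<le> a')}"
    have "A = {s. atom s \<and> s \<le> a} \<union> {s. atom s \<and> s \<le> a'}"
      by (auto simp: A_def)
    then have "sup a a' = Sup A"
      by (simp add: Sup_union_distrib eq_Sup_atoms[OF geo, symmetric])
    then have "r \<le> Sup {s \<in> A. colour s = colour r}"
      using that(3) by (intro atom_le_Sup_same_colour[OF geo colour r(1)]) (auto simp: A_def)
    also have "\<dots> \<le> sup b b'"
    proof (rule Sup_least)
      fix s assume "s \<in> {s \<in> A. colour s = colour r}"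
      then have "s \<le> b \<or> s \<le> b'"
        using r(2) \<theta> by (auto simp: A_def \<theta>_def)
      then show "s \<le> sup b b'"
        by (auto intro: le_supI1 le_supI2)
    qed
    finally show ?thesis .
  qed
  have sym: "(b, a) \<in> \<theta>" if "(a, b) \<in> \<theta>" for a b
    using that by (auto simp: \<theta>_def)
  have "lattice_congruence \<theta>"
    unfolding lattice_congruence_def
  proof (intro conjI allI impI)
    show "equiv UNIV \<theta>"
    proof (rule equivI)
      show "trans \<theta>"
        unfolding \<theta>_def by (rule transI) blast
    qed (auto simp: \<theta>_def intro!: reflI symI)
  next
    fix a b a' b' assume 1: "(a, b) \<in> \<theta>" "(a', b') \<in> \<theta>"
    then show "(inf a a', inf b b') \<in> \<theta>"
      by (auto simp: \<theta>_def)
    show "(sup a a', sup b b') \<in> \<theta>"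
      using le_sup[OF _ _ _ 1] le_sup[OF _ _ _ sym[OF 1(1)] sym[OF 1(2)]]
      unfolding \<theta>_def by blast
  qed
  moreover have "(bot, p) \<in> \<theta>"
  proof -
    have "r = p" if "atom r" "r \<le> p" for r
      using covered_by_between[of bot p r] p that by (auto simp: atom_def covered_by_def)
    moreover have "\<not> r \<le> bot" if "atom r" for r
      using that by (auto simp: atom_def covered_by_def)
    ultimately show ?thesis
      unfolding \<theta>_def by blast
  qed
  moreover have "bot \<noteq> p"
    using p by (auto simp: atom_def covered_by_def)
  ultimately have "\<theta> = UNIV"
    using simple by (auto simp: simple_lattice_def)
  then have "(bot, q) \<in> \<theta>"
    by simp
  then have "q \<le> bot"
    using q neq by (auto simp: \<theta>_def)
  then show False
    using q by (auto simp: atom_def covered_by_def)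
qed

lemma Delta_sup_atom:
  fixes p x :: "'a::complete_lattice"
  assumes "atom p" "\<not> p \<le> x"
  shows "Delta x (sup x p) = Delta bot p"
  using Delta_sup[of x p] Delta_inf[of x p] inf_atom_eq_bot[OF assms] by simp

text \<open>
  The colour of an atom \<open>p\<close> is \<open>Delta bot p\<close>; perspective atoms share it because both equal the
  class of the interval \<open>[x, sup x p] = [x, sup x q]\<close>.
\<close>

lemma simple_geometric_Delta_covered_by:
  assumes geo: "geometric_lattice TYPE('a::complete_lattice)"
    and simple: "simple_lattice TYPE('a::complete_lattice)"
  obtains e :: "('a::complete_lattice) dimension" and p :: 'a
  where "atom p" "\<And>x y. covered_by x y \<Longrightarrow> Delta x y = e"
proof -
  obtain a b :: 'a where "\<not> a \<le> b"
    using simple unfolding simple_lattice_def nontrivial_lattice_def by (metis antisym)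
  then obtain p :: 'a where p: "atom p"
    using geometric_exists_atom_below[OF geo] by metis
  have "Delta x y = Delta bot p" if xy: "covered_by x y" for x y
  proof -
    obtain q where q: "atom q" "q \<le> y" "\<not> q \<le> x"
      using geometric_exists_atom_below[OF geo, of y x] covered_by_less[OF xy] by (auto simp: less_le_not_le)
    then have "Delta x y = Delta bot q"
      using covered_by_eq_sup_atom[OF xy q(2,3)] Delta_sup_atom[OF q(1,3)] by simp
    also have "Delta bot q = Delta bot p"
    proof (rule simple_geometric_atoms_same_colour[OF geo simple _ q(1) p])
      fix r s z :: 'a
      assume "atom r" "atom s" "\<not> r \<le> z" "\<not> s \<le> z" "sup z r = sup z s"
      then show "Delta bot r = Delta bot s"
        using Delta_sup_atom[of r z] Delta_sup_atom[of s z] by simp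
    qed
    finally show ?thesis .
  qed
  then show thesis
    using that p by blast
qed


section \<open>The modular case\<close>

inductive cover_chain :: "nat \<Rightarrow> 'a::order \<Rightarrow> 'a \<Rightarrow> bool" where
  refl: "cover_chain 0 a a"
| step: "covered_by a b \<Longrightarrow> cover_chain n b c \<Longrightarrow> cover_chain (Suc n) a c"

inductive_cases cover_chain_0E: "cover_chain 0 a b"
inductive_cases cover_chain_SucE: "cover_chain (Suc n) a b"

lemma cover_chain_le: "cover_chain n a b \<Longrightarrow> a \<le> b"
proof (induction rule: cover_chain.induct)
  case (step a b n c)
  then show ?case
    using covered_by_less[OF step.hyps(1)] by simp
qed simp

lemma cover_chain_trans:
  "cover_chain m a b \<Longrightarrow> cover_chain n b c \<Longrightarrow> cover_chain (m + n) a c"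
proof (induction rule: cover_chain.induct)
  case (step a b m b')
  then show ?case
    using cover_chain.step[of a b "m + n" c] by simp
qed simp

text \<open>
  The Jordan--Hoelder exchange step: a chain of covers from \<open>a\<close> to \<open>b\<close> can be rerouted through
  any cover \<open>c \<le> b\<close> of \<open>a\<close> without changing its length, since by semimodularity \<open>sup c d\<close>
  covers both \<open>c\<close> and the old first step \<open>d\<close>.
\<close>

lemma cover_chain_through:
  fixes a b c :: "'a::lattice"
  assumes "semimodular_lattice TYPE('a)"
    and "cover_chain (Suc n) a b" "covered_by a c" "c \<le> b"
  shows "cover_chain n c b"
  using assms(2-)
proof (induction n arbitrary: a c)
  case (0 a c)
  then have "covered_by a b"
    by (auto elim!: cover_chain_SucE cover_chain_0E)
  then show ?case
    using covered_by_between[OF _ less_imp_le[OF covered_by_less[OF 0(2)]] 0(3)]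
      covered_by_less[OF 0(2)] by (auto intro: cover_chain.refl)
next
  case (Suc n a c)
  from Suc.prems(1) obtain d where d: "covered_by a d" "cover_chain (Suc n) d b"
    by (auto elim: cover_chain_SucE)
  show ?case
  proof (cases "c = d")
    case False
    have "a < c" "a < d"
      using d(1) Suc.prems(2) by (simp_all add: covered_by_less)
    then have "\<not> c \<le> d"
      using covered_by_between[OF d(1) less_imp_le[OF \<open>a < c\<close>]] False by auto
    then have "inf c d = a"
      using covered_by_inf_cases[OF Suc.prems(2), of d] \<open>a < d\<close> by auto
    then have "covered_by (inf c d) c" "covered_by (inf d c) d"
      using d(1) Suc.prems(2) by (simp_all add: inf.commute)
    then have "covered_by d (sup c d)" "covered_by c (sup d c)"
      using assms(1) unfolding semimodular_lattice_def by blast+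
    then have "covered_by d (sup c d)" "covered_by c (sup c d)"
      by (simp_all add: sup.commute)
    moreover have "sup c d \<le> b"
      using Suc.prems(3) cover_chain_le[OF d(2)] by simp
    ultimately show ?thesis
      using Suc.IH[OF d(2)] cover_chain.step by blast
  qed (use d in simp)
qed

lemma cover_chain_unique:
  fixes a b :: "'a::lattice"
  assumes "semimodular_lattice TYPE('a)" "cover_chain m a b" "cover_chain n a b"
  shows "m = n"
  using assms(2,3)
proof (induction arbitrary: n rule: cover_chain.induct)
  case (refl a)
  show ?case
  proof (cases n)
    case (Suc k)
    then obtain b where "covered_by a b" "cover_chain k b a"
      using refl by (auto elim: cover_chain_SucE)
    then show ?thesis
      using covered_by_less[of a b] cover_chain_le[of k b a] by simp
  qed simp
next
  case (step a b m c)
  have "a < c"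
    using covered_by_less[OF step.hyps(1)] cover_chain_le[OF step.hyps(2)] by simp
  then have "n \<noteq> 0"
    using step.prems by (cases n) (auto elim: cover_chain_0E)
  then obtain k where "n = Suc k"
    using not0_implies_Suc by blast
  then have "cover_chain k b c"
    using cover_chain_through[OF assms(1) _ step.hyps(1) cover_chain_le[OF step.hyps(2)]] step.prems
    by blast
  then show ?case
    using step.IH \<open>n = Suc k\<close> by simp
qed

lemma cover_chain_map:
  fixes h :: "'a::order \<Rightarrow> 'b::order"
  assumes "cover_chain n a b"
    and "\<And>x y. covered_by x y \<Longrightarrow> h x = h y \<or> covered_by (h x) (h y)"
  shows "\<exists>m. cover_chain m (h a) (h b)"
  using assms(1)
proof (induction rule: cover_chain.induct)
  case (refl a)
  show ?case
    by (rule exI) (rule cover_chain.refl)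
next
  case (step a b n c)
  then obtain m where m: "cover_chain m (h b) (h c)"
    by blast
  from assms(2)[OF step.hyps(1)] show ?case
  proof
    assume "h a = h b"
    with m show ?thesis
      by auto
  next
    assume "covered_by (h a) (h b)"
    from cover_chain.step[OF this m] show ?thesis
      by (rule exI)
  qed
qed

lemma modular_covered_by_inf_cases:
  fixes a b t :: "'a::lattice"
  assumes "modular_lattice TYPE('a)" and ab: "covered_by a b"
  shows "inf a t = inf b t \<or> covered_by (inf a t) (inf b t)"
proof (rule disjCI, rule ccontr)
  assume "\<not> covered_by (inf a t) (inf b t)" "\<not> inf a t = inf b t"
  moreover have "inf a t \<le> inf b t"
    using covered_by_less[OF ab] by (meson inf_mono less_imp_le order_refl)
  ultimately obtain u where u: "inf a t < u" "u < inf b t"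
    by (auto simp: covered_by_def less_le)
  then have "\<not> u \<le> a"
    by (metis inf.boundedE le_inf_iff less_le_not_le)
  then have "b = sup a u"
    using covered_by_between[OF ab, of "sup a u"] covered_by_less[OF ab] u(2)
    by (metis inf.boundedE le_supI less_imp_le sup_ge1 sup_ge2)
  then have "inf b t = inf (sup u a) (inf b t)"
    by (simp add: sup.commute)
  also have "\<dots> = sup u (inf a (inf b t))"
    using assms(1) u(2) by (metis less_imp_le modular_lattice_def)
  also have "\<dots> = u"
    using u covered_by_less[OF ab] by (metis inf.absorb1 inf.assoc less_imp_le sup.absorb1)
  finally show False
    using u by simp
qed

text \<open>
  Transposition \<open>x \<mapsto> sup a x\<close> from \<open>[inf a b, b]\<close> to \<open>[a, sup a b]\<close> preserves covers, not just
  weakly: modularity recovers \<open>x\<close> as \<open>inf y (sup x a)\<close>.  Hence length satisfies (D2).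
\<close>

lemma modular_cover_chain_sup:
  fixes a b :: "'a::complete_lattice"
  assumes geo: "geometric_lattice TYPE('a)" and mod: "modular_lattice TYPE('a)"
    and "cover_chain n x b" "inf a b \<le> x"
  shows "cover_chain n (sup a x) (sup a b)"
  using assms(3,4)
proof (induction rule: cover_chain.induct)
  case (step x y n b)
  have xy: "x < y" and yb: "y \<le> b"
    using step covered_by_less cover_chain_le by blast+
  have "inf y (sup x a) = sup x (inf a y)"
    using mod xy unfolding modular_lattice_def by (metis inf.commute less_imp_le)
  also have "\<dots> = x"
    using step.prems yb by (meson inf_mono order_refl order_trans sup.absorb1)
  finally have "covered_by (sup x a) (sup y (sup x a))"
    using step.hyps(1) geo unfolding geometric_lattice_def semimodular_lattice_def by metis
  moreover have "sup y (sup x a) = sup a y"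
    using xy by (metis less_imp_le sup.absorb1 sup.assoc sup.commute)
  moreover have "cover_chain n (sup a y) (sup a b)"
    using step xy by (meson less_imp_le order_trans)
  ultimately show ?case
    by (auto simp: sup.commute intro: cover_chain.step)
qed (rule cover_chain.refl)

lemma Dim_iso_nat:
  assumes geo: "geometric_lattice TYPE('a::complete_lattice)"
    and simple: "simple_lattice TYPE('a::complete_lattice)"
    and mod: "modular_lattice TYPE('a)"
  shows "Dim TYPE('a) \<cong> nat_monoid"
proof -
  obtain e :: "'a dimension" and p :: 'a
    where p: "atom p" and e: "\<And>x y. covered_by x y \<Longrightarrow> Delta x y = e"
    using simple_geometric_Delta_covered_by[OF geo simple] by metis
  have semi: "semimodular_lattice TYPE('a)"
    using geo by (simp add: geometric_lattice_def)
  have chain_ex: "\<exists>n. cover_chain n x y" if "x \<le> y" for x y :: 'a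
  proof (rule simple_lattice_interval_property[OF simple, where G = "\<lambda>x y. \<exists>n. cover_chain n x y"])
    show "bot < p" "\<exists>n. cover_chain n bot p"
      using p by (auto simp: atom_def dest: covered_by_less intro: cover_chain.intros)
    show "\<exists>n. cover_chain n (sup a t) (sup b t)" if "\<exists>n. cover_chain n a b" for a b t :: 'a
      using that cover_chain_map[where h = "\<lambda>x. sup x t"] covered_by_sup_cases[OF geo] by metis
    show "\<exists>n. cover_chain n (inf a t) (inf b t)" if "\<exists>n. cover_chain n a b" for a b t :: 'a
      using that cover_chain_map[where h = "\<lambda>x. inf x t"] modular_covered_by_inf_cases[OF mod]
      by metis
  qed (use that in \<open>auto intro: cover_chain.refl cover_chain_trans\<close>)
  define len where "len a b = (THE n. cover_chain n a b)" for a b :: 'a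
  have lenI: "len a b = n" if "cover_chain n a b" for a b n
    unfolding len_def using that cover_chain_unique[OF semi] by blast
  have len: "cover_chain (len a b) a b" if "a \<le> b" for a b
    using chain_ex[OF that] lenI by metis
  define g where "g n = (\<Sum>i<n. e)" for n :: nat
  have g_add: "g (m + n) = g m + g n" for m n
    by (induction n) (simp_all add: g_def add.assoc)
  have g_chain: "Delta a b = g n" if "cover_chain n a b" for n a b
    using that
  proof (induction rule: cover_chain.induct)
    case (step a b n c)
    then have "Delta a c = Delta a b + Delta b c"
      by (intro Delta_split) (auto dest: covered_by_less cover_chain_le)
    then show ?case
      using step e by (simp add: g_def add.commute)
  qed (simp add: g_def)
  show ?thesis
  proof (rule Dim_iso_if_dimension_function[where f = len and g = g])
    show "len a a = 0" for a
      by (rule lenI) (rule cover_chain.refl)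
    show "len a c = len a b + len b c" if "a \<le> b" "b \<le> c" for a b c
      by (rule lenI) (rule cover_chain_trans[OF len[OF that(1)] len[OF that(2)]])
    show "len a (sup a b) = len (inf a b) b" for a b
    proof (rule lenI)
      have "cover_chain (len (inf a b) b) (sup a (inf a b)) (sup a b)"
        by (rule modular_cover_chain_sup[OF geo mod len]) auto
      then show "cover_chain (len (inf a b) b) a (sup a b)"
        by simp
    qed
    show "carrier nat_monoid = (\<lambda>M. \<Sum>(a, b)\<in>#M. len a b) ` formal_sums"
    proof -
      have "n \<in> (\<lambda>M. \<Sum>(a, b)\<in>#M. len a b) ` formal_sums" for n
      proof (rule image_eqI)
        have "len bot p = 1"
          using p by (auto simp: atom_def intro!: lenI cover_chain.intros)
        then show "n = (\<Sum>(a, b)\<in>#replicate_mset n (bot, p). len a b)"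
          by (induction n) simp_all
        show "replicate_mset n (bot, p) \<in> formal_sums"
          by (auto simp: formal_sums_def)
      qed
      then show ?thesis
        by (auto simp: nat_monoid_def)
    qed
    show "monoid.mult nat_monoid = (+)"
      by (simp add: nat_monoid_def)
    show "g 0 = 0"
      by (simp add: g_def)
  qed (auto simp: g_add g_chain[OF len])
qed


section \<open>The nonmodular case\<close>

text \<open>
  The modular inequality is tested on atoms \<open>p\<close> below \<open>c\<close> and below \<open>sup a b\<close>, and by compactness
  only for finite joins of atoms in place of \<open>b\<close>.  In the induction, a new atom \<open>q\<close> is moved to
  \<open>a\<close> and to \<open>c\<close>.  If \<open>q\<close> is not below \<open>c\<close>, the hypothesis bounds how much \<open>inf b c\<close> grows when
  \<open>c\<close> is enlarged to \<open>sup c q\<close>: exactly by \<open>q\<close>, which exchange then removes again.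
\<close>

lemma geometric_modular_if_covers_meet:
  assumes geo: "geometric_lattice TYPE('a::complete_lattice)"
    and meet: "\<And>x y z :: 'a. covered_by x y \<Longrightarrow>
      inf x z = inf y z \<or> covered_by (inf x z) (inf y z)"
  shows "modular_lattice TYPE('a)"
proof -
  have fin: "p \<le> sup a (inf (Sup F) c)"
    if "finite F" "\<forall>q\<in>F. atom q" "atom p" "a \<le> c" "p \<le> c" "p \<le> sup a (Sup F)"
    for F and p a c :: 'a
    using that
  proof (induction F arbitrary: a c rule: finite_induct)
    case empty
    then show ?case by simp
  next
    case (insert q F)
    define b where "b = Sup (insert q F)"
    have q: "atom q" "q \<le> b"
      using insert.prems by (auto simp: b_def)
    have "p \<le> sup (sup a q) (inf (Sup F) (sup c q))"
      using insert.prems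
      by (intro insert.IH) (auto simp: sup.assoc intro: le_supI1 le_supI2)
    also have "\<dots> \<le> sup a (inf b (sup c q))"
      by (rule le_supI[OF le_supI[OF sup_ge1 le_supI2] le_supI2]) (auto simp: b_def intro: le_infI1 le_supI2)
    finally have p: "p \<le> sup a (inf b (sup c q))" .
    show ?case
    proof (cases "q \<le> c")
      case True
      then show ?thesis
        using p by (simp add: sup.absorb1 b_def)
    next
      case False
      have "covered_by c (sup c q)"
        using covered_by_sup_atom[OF geo q(1) False] .
      moreover have "q \<le> inf (sup c q) b" "\<not> q \<le> inf c b"
        using q False by auto
      ultimately have "covered_by (inf c b) (inf (sup c q) b)"
        using meet by metis
      then have "inf (sup c q) b = sup (inf c b) q"
        using covered_by_eq_sup_atom \<open>q \<le> inf (sup c q) b\<close> \<open>\<not> q \<le> inf c b\<close> by blast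
      then have p': "p \<le> sup (sup a (inf b c)) q"
        using p by (simp add: sup.assoc inf.commute)
      have "p \<le> sup a (inf b c)"
      proof (rule ccontr)
        assume "\<not> p \<le> sup a (inf b c)"
        then have "sup (sup a (inf b c)) p = sup (sup a (inf b c)) q"
          using atom_exchange[OF geo \<open>atom p\<close> q(1) p'] by blast
        moreover have "sup (sup a (inf b c)) p \<le> c"
          using insert.prems by simp
        ultimately show False
          using False by simp
      qed
      then show ?thesis
        by (simp add: b_def)
    qed
  qed
  have "inf (sup a b) c \<le> sup a (inf b c)" if ac: "a \<le> c" for a b c :: 'a
  proof (rule ccontr)
    assume "\<not> ?thesis"
    then obtain p where p: "atom p" "p \<le> inf (sup a b) c" "\<not> p \<le> sup a (inf b c)"
      using geometric_exists_atom_below[OF geo] by metis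
    define B where "B = {q. atom q \<and> q \<le> b}"
    have "p \<le> Sup (insert a B)"
      using p(2) eq_Sup_atoms[OF geo, of b] by (simp add: B_def)
    then obtain F where F: "finite F" "F \<subseteq> insert a B" "p \<le> Sup F"
      using atom_compact[OF geo p(1)] unfolding compact_element_def by metis
    define F' where "F' = F - {a}"
    have "Sup F \<le> sup a (Sup F')"
    proof (rule Sup_least)
      fix x assume "x \<in> F"
      then show "x \<le> sup a (Sup F')"
        by (cases "x = a") (auto simp: F'_def intro: le_supI2 Sup_upper)
    qed
    then have "p \<le> sup a (inf (Sup F') c)"
      using fin[of F' p a c] F p ac by (auto simp: F'_def B_def intro: order_trans)
    moreover have "Sup F' \<le> b"
      using F(2) by (auto simp: F'_def B_def intro!: Sup_least)
    ultimately show False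
      using p(3) by (meson inf_mono order_refl order_trans sup_mono)
  qed
  then show ?thesis
    unfolding modular_lattice_def 
    by (auto intro!: antisym simp: le_supI2 le_infI1)
qed

text \<open>
  Above \<open>u = inf x z\<close> there is room for an interval \<open>[u, s]\<close> of length two with \<open>s \<le> inf y z\<close>.
  It transposes up to the cover \<open>[x, y]\<close>, so its class \<open>e + e\<close> equals \<open>e\<close>.
\<close>

lemma nonmodular_Delta_covered_by_idempotent:
  fixes e :: "('a::complete_lattice) dimension"
  assumes geo: "geometric_lattice TYPE('a)" and nonmod: "\<not> modular_lattice TYPE('a)"
    and e: "\<And>x y :: 'a. covered_by x y \<Longrightarrow> Delta x y = e"
  shows "e + e = e"
proof -
  obtain x y z :: 'a where xy: "covered_by x y"
    and neq: "inf x z \<noteq> inf y z" and ncov: "\<not> covered_by (inf x z) (inf y z)"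
    using geometric_modular_if_covers_meet[OF geo] nonmod by metis
  define u v where "u = inf x z" and "v = inf y z"
  have "u < v"
    using neq covered_by_less[OF xy] by (simp add: u_def v_def less_le le_infI1)
  then obtain w where w: "u < w" "w < v"
    using ncov by (auto simp: covered_by_def u_def v_def)
  obtain q where q: "atom q" "q \<le> w" "\<not> q \<le> u"
    using geometric_exists_atom_below[OF geo, of w u] w(1) by (auto simp: less_le_not_le)
  obtain r where r: "atom r" "r \<le> v" "\<not> r \<le> w"
    using geometric_exists_atom_below[OF geo, of v w] w(2) by (auto simp: less_le_not_le)
  define s where "s = sup (sup u q) r"
  have "\<not> r \<le> sup u q"
    using q w r(3) by (meson le_supI less_imp_le order_trans)
  then have 1: "covered_by u (sup u q)" "covered_by (sup u q) s"
    using covered_by_sup_atom[OF geo] q r by (simp_all add: s_def)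
  have "s \<le> v"
    using w q r by (auto simp: s_def)
  have "u \<le> s"
    by (simp add: s_def sup.assoc)
  have "inf x s = u"
  proof (rule antisym)
    show "inf x s \<le> u"
      using \<open>s \<le> v\<close> by (auto simp: u_def v_def intro: le_infI2)
    show "u \<le> inf x s"
      using \<open>u \<le> s\<close> by (simp add: u_def)
  qed
  moreover have "\<not> s \<le> x"
  proof
    assume "s \<le> x"
    then have "s = u"
      using \<open>inf x s = u\<close> by (simp add: inf.absorb2)
    then show False
      using q(3) by (metis s_def sup.assoc sup.cobounded1 sup.cobounded2 order_trans)
  qed
  moreover have "s \<le> y"
    using \<open>s \<le> v\<close> by (simp add: v_def)
  ultimately have "Delta u s = Delta x y"
    using covered_by_eq_sup_atom[OF xy] Delta_sup Delta_inf by metis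
  then have "e = Delta u s"
    using e[OF xy] by simp
  also have "\<dots> = Delta u (sup u q) + Delta (sup u q) s"
    by (rule Delta_split) (auto simp: s_def)
  also have "\<dots> = e + e"
    using e[OF 1(1)] e[OF 1(2)] by simp
  finally show ?thesis ..
qed

text \<open>
  The interval \<open>[u, v]\<close> compared with an element \<open>c\<close>.  Its lower part \<open>[u, w]\<close> with
  \<open>w = sup u (inf v c)\<close> and its upper part \<open>[w', v]\<close> with \<open>w' = inf v (sup u c)\<close> are transposes of
  the intervals cut out by meeting and joining with \<open>c\<close>.  What is left is the critical interval
  \<open>[w, w']\<close> of a pentagon, whose ends have the same meet and the same join with \<open>c\<close>: it
  vanishes in a modular lattice, and in general it is absorbed by both sides of the pentagon
  adjacent to \<open>c\<close>.
\<close>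

lemma Delta_pentagon:
  fixes u v c :: "'a::lattice"
  assumes uv: "u \<le> v"
  obtains w w' where "u \<le> w" "w \<le> w'" "w' \<le> v"
    "Delta u v = Delta (inf u c) (inf v c) + Delta w w' + Delta (sup u c) (sup v c)"
    "Delta c (sup u c) + Delta w w' = Delta c (sup u c)"
    "Delta (inf v c) c + Delta w w' = Delta (inf v c) c"
proof
  define w w' where "w = sup u (inf v c)" and "w' = inf v (sup u c)"
  show le: "u \<le> w" "w \<le> w'" "w' \<le> v"
    using uv by (auto simp: w_def w'_def intro: le_infI1 le_infI2 le_supI1 le_supI2)
  have sups: "sup w c = sup u c" "sup w' c = sup u c"
  proof -
    have "sup u c \<le> sup w c" "sup w c \<le> sup w' c" "sup w' c \<le> sup u c"
      using le by (auto simp: w'_def intro: le_supI1)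
    then show "sup w c = sup u c" "sup w' c = sup u c"
      by (metis order_antisym order_trans)+
  qed
  have infs: "inf w c = inf v c" "inf w' c = inf v c"
  proof -
    have "inf v c \<le> inf w c" "inf w c \<le> inf w' c" "inf w' c \<le> inf v c"
      using le by (auto simp: w_def intro: le_infI1)
    then show "inf w c = inf v c" "inf w' c = inf v c"
      by (metis order_antisym order_trans)+
  qed
  have "inf u (inf v c) = inf u c"
    using uv by (metis inf.absorb1 inf.assoc)
  then have "Delta u w = Delta (inf u c) (inf v c)"
    by (metis Delta_inf Delta_sup w_def)
  moreover have "sup (sup u c) v = sup v c"
    using uv by (metis sup.absorb2 sup.assoc sup.commute)
  then have "Delta w' v = Delta (sup u c) (sup v c)"
    by (metis Delta_inf Delta_sup inf.commute w'_def)
  moreover have "Delta u v = Delta u w + Delta w w' + Delta w' v"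
    using le by (metis Delta_split order_trans)
  ultimately show "Delta u v = Delta (inf u c) (inf v c) + Delta w w' + Delta (sup u c) (sup v c)"
    by simp
  have "Delta c (sup u c) = Delta (inf w' c) w'"
    by (metis sups(2) Delta_inf Delta_sup inf.commute sup.commute)
  also have "\<dots> = Delta (inf w c) w + Delta w w'"
    using le by (metis Delta_split infs inf_le1)
  also have "Delta (inf w c) w = Delta c (sup u c)"
    by (metis sups(1) Delta_inf Delta_sup inf.commute sup.commute)
  finally show "Delta c (sup u c) + Delta w w' = Delta c (sup u c)" ..
  have "Delta (inf v c) c = Delta w (sup w c)"
    by (metis infs(1) Delta_inf Delta_sup)
  also have "\<dots> = Delta w w' + Delta w' (sup w' c)"
    using le by (metis Delta_split sups sup_ge1)
  also have "Delta w' (sup w' c) = Delta (inf v c) c"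
    by (metis infs(2) Delta_inf Delta_sup)
  finally show "Delta (inf v c) c + Delta w w' = Delta (inf v c) c"
    by (simp add: add.commute)
qed

text \<open>
  In an interval \<open>w < w'\<close> a cover can be split off, so its class absorbs the idempotent \<open>e\<close>.
  If conversely \<open>Delta w w'\<close> is absorbed by \<open>0\<close> or \<open>e\<close>, it must be \<open>0\<close> or \<open>e\<close>.  With the pentagon
  decomposition this makes ``every subinterval has class \<open>0\<close> or \<open>e\<close>'' a property as required by
  \<open>simple_lattice_interval_property\<close>, starting from the interval of an atom.
\<close>

lemma nonmodular_Delta_less:
  fixes e :: "('a::complete_lattice) dimension"
  assumes geo: "geometric_lattice TYPE('a)" and simple: "simple_lattice TYPE('a)"
    and p: "atom (p :: 'a)" and e: "\<And>x y :: 'a. covered_by x y \<Longrightarrow> Delta x y = e"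
    and idem: "e + e = e"
    and "x < y"
  shows "Delta x y = e"
proof -
  define Z where "Z = {0, e}"
  have Z_add: "s + t \<in> Z" if "s \<in> Z" "t \<in> Z" for s t
    using that idem by (auto simp: Z_def)
  have Delta_e: "Delta w w' + e = Delta w w'" if "w < w'" for w w'
  proof -
    obtain q where q: "atom q" "q \<le> w'" "\<not> q \<le> w"
      using geometric_exists_atom_below[OF geo, of w' w] \<open>w < w'\<close> by (auto simp: less_le_not_le)
    have "Delta w w' = Delta w (sup w q) + Delta (sup w q) w'"
      using q \<open>w < w'\<close> by (intro Delta_split) auto
    then have "Delta w w' = e + Delta (sup w q) w'"
      using e[OF covered_by_sup_atom[OF geo q(1,3)]] by simp
    then show ?thesis
      using idem by (metis add.assoc add.commute)
  qed
  have absorbed: "Delta w w' \<in> Z" if "w \<le> w'" "m \<in> Z" "m + Delta w w' = m" for w w' m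
  proof (cases "w = w'")
    case False
    then have "Delta w w' + e = Delta w w'"
      using Delta_e that(1) by auto
    then show ?thesis
      using that(2,3) by (auto simp: Z_def add.commute)
  qed (simp add: Z_def)
  have pentagon: "Delta u v \<in> Z"
    if uv: "u \<le> v" and ends: "Delta (inf u c) (inf v c) \<in> Z" "Delta (sup u c) (sup v c) \<in> Z"
      and c: "Delta c (sup u c) \<in> Z \<or> Delta (inf v c) c \<in> Z" for u v c
  proof -
    obtain w w' where w: "w \<le> w'"
      "Delta u v = Delta (inf u c) (inf v c) + Delta w w' + Delta (sup u c) (sup v c)"
      "Delta c (sup u c) + Delta w w' = Delta c (sup u c)"
      "Delta (inf v c) c + Delta w w' = Delta (inf v c) c"
      using Delta_pentagon[OF uv, of c] by metis
    have "Delta w w' \<in> Z"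
      using c absorbed[OF w(1) _ w(3)] absorbed[OF w(1) _ w(4)] by blast
    then show ?thesis
      using w(2) ends Z_add by simp
  qed
  define G where "G a b \<longleftrightarrow> (\<forall>u v. a \<le> u \<longrightarrow> u \<le> v \<longrightarrow> v \<le> b \<longrightarrow> Delta u v \<in> Z)" for a b :: 'a
  have GI: "G a b" if "\<And>u v. a \<le> u \<Longrightarrow> u \<le> v \<Longrightarrow> v \<le> b \<Longrightarrow> Delta u v \<in> Z" for a b
    using that by (simp add: G_def)
  have GD: "Delta u v \<in> Z" if "G a b" "a \<le> u" "u \<le> v" "v \<le> b" for a b u v
    using that by (auto simp: G_def)
  have zero: "0 \<in> Z"
    by (simp add: Z_def)
  have "G x y"
  proof (rule simple_lattice_interval_property[OF simple, where G = G])
    show "bot < p"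
      using p by (simp add: atom_def covered_by_less)
    show "G bot p"
    proof (rule GI)
      fix u v :: 'a assume "u \<le> v" "v \<le> p"
      then have "u = v \<or> u = bot \<and> v = p"
        using p covered_by_between[of bot p u] covered_by_between[of bot p v]
        by (auto simp: atom_def bot_unique intro: order_trans)
      then show "Delta u v \<in> Z"
        using e[of bot p] p by (auto simp: atom_def Z_def)
    qed
    show "G a a" for a
      by (rule GI) (use antisym zero in \<open>force\<close>)
    show "G a c" if "a \<le> b" "b \<le> c" and G: "G a b" "G b c" for a b c
    proof (rule GI)
      fix u v assume uv: "a \<le> u" "u \<le> v" "v \<le> c"
      show "Delta u v \<in> Z"
      proof (rule pentagon[of u v b])
        show "Delta (inf u b) (inf v b) \<in> Z"
          using uv that by (intro GD[OF G(1)]) (auto intro: le_infI1)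
        show "Delta (sup u b) (sup v b) \<in> Z"
          using uv that by (intro GD[OF G(2)]) (auto intro: le_supI1)
        show "Delta b (sup u b) \<in> Z \<or> Delta (inf v b) b \<in> Z"
          using uv that by (intro disjI2 GD[OF G(1)]) auto
      qed (fact uv)
    qed
    show "G (sup a t) (sup b t)" if "a \<le> b" and G: "G a b" for a b t
    proof (rule GI)
      fix u v assume uv: "sup a t \<le> u" "u \<le> v" "v \<le> sup b t"
      show "Delta u v \<in> Z"
      proof (rule pentagon[of u v b])
        show "Delta (inf u b) (inf v b) \<in> Z"
          using uv that by (intro GD[OF G]) (auto intro: le_infI1)
        have "t \<le> u" "t \<le> v" "u \<le> sup b t"
          using uv by (auto intro: order_trans)
        then have "sup u b = sup b t" "sup v b = sup b t"
          using uv by (auto intro!: antisym intro: le_supI1)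
        then show "Delta (sup u b) (sup v b) \<in> Z"
          using zero by simp
        show "Delta b (sup u b) \<in> Z \<or> Delta (inf v b) b \<in> Z"
          using uv that by (intro disjI2 GD[OF G]) auto
      qed (fact uv)
    qed
    show "G (inf a t) (inf b t)" if "a \<le> b" and G: "G a b" for a b t
    proof (rule GI)
      fix u v assume uv: "inf a t \<le> u" "u \<le> v" "v \<le> inf b t"
      show "Delta u v \<in> Z"
      \<comment> \<open>Here \<open>inf u a\<close> leaves \<open>[a, b]\<close> but \<open>sup u a\<close> does not, so the upper side absorbs.\<close>
      proof (rule pentagon[of u v a])
        show "Delta (sup u a) (sup v a) \<in> Z"
          using uv that by (intro GD[OF G]) (auto intro: le_supI1)
        have "u \<le> t" "v \<le> t" "inf a t \<le> v"
          using uv by (auto intro: order_trans)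
        then have "inf u a = inf a t" "inf v a = inf a t"
          using uv by (auto intro!: antisym intro: le_infI1)
        then show "Delta (inf u a) (inf v a) \<in> Z"
          using zero by simp
        show "Delta a (sup u a) \<in> Z \<or> Delta (inf v a) a \<in> Z"
          using uv that by (intro disjI1 GD[OF G]) auto
      qed (fact uv)
    qed
  qed (use \<open>x < y\<close> in auto)
  then have "Delta x y \<in> Z"
    using \<open>x < y\<close> by (intro GD) auto
  then show ?thesis
    using Delta_e[OF \<open>x < y\<close>] by (auto simp: Z_def)
qed

lemma Dim_iso_two:
  assumes geo: "geometric_lattice TYPE('a::complete_lattice)"
    and simple: "simple_lattice TYPE('a::complete_lattice)"
    and nonmod: "\<not> modular_lattice TYPE('a)"
  shows "Dim TYPE('a) \<cong> two_monoid"
proof -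
  obtain e :: "'a dimension" and p :: 'a
    where p: "atom p" and e: "\<And>x y. covered_by x y \<Longrightarrow> Delta x y = e"
    using simple_geometric_Delta_covered_by[OF geo simple] by metis
  have idem: "e + e = e"
    using nonmodular_Delta_covered_by_idempotent[OF geo nonmod e] .
  have Delta: "Delta x y = e" if "x < y" for x y
    using nonmodular_Delta_less[OF geo simple p e idem that] .
  define f where "f a b = (if a = b then 0 else \<infinity> :: enat)" for a b :: 'a
  define g where "g n = (if n = 0 then 0 else e)" for n :: enat
  show ?thesis
  proof (rule Dim_iso_if_dimension_function[where f = f and g = g])
    show "f a c = f a b + f b c" if "a \<le> b" "b \<le> c" for a b c
      using that by (auto simp: f_def)
    show "f a (sup a b) = f (inf a b) b" for a b
    proof -
      have "a = sup a b \<longleftrightarrow> inf a b = b"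
        by (metis inf.absorb2 inf_le1 sup.absorb1 sup_ge2)
      then show ?thesis
        by (simp add: f_def)
    qed
    show "g (f a b) = Delta a b" if "a \<le> b" for a b
      using that Delta[of a b] by (auto simp: f_def g_def)
    show "carrier two_monoid = (\<lambda>M. \<Sum>(a, b)\<in>#M. f a b) ` formal_sums"
    proof
      have "(\<Sum>(a, b)\<in>#M. f a b) \<in> {0, \<infinity>}" for M
      proof (induction M)
        case (add x M)
        have "s + t \<in> {0, \<infinity>}" if "s \<in> {0, \<infinity>}" "t \<in> {0, \<infinity>}" for s t :: enat
          using that by auto
        moreover have "(case x of (a, b) \<Rightarrow> f a b) \<in> {0, \<infinity>}"
          by (cases x) (simp add: f_def)
        ultimately show ?case
          unfolding image_mset_add_mset sum_mset.add_mset using add by metis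
      qed simp
      then show "(\<lambda>M. \<Sum>(a, b)\<in>#M. f a b) ` formal_sums \<subseteq> carrier two_monoid"
        unfolding two_monoid_def partial_object.simps by (rule image_subsetI)
      have "bot \<noteq> p"
        using p by (auto simp: atom_def covered_by_def)
      then have "\<infinity> = (\<Sum>(a, b)\<in>#{#(bot, p)#}. f a b)" "{#(bot, p)#} \<in> formal_sums"
        by (simp_all add: f_def formal_sums_def)
      then have "\<infinity> \<in> (\<lambda>M. \<Sum>(a, b)\<in>#M. f a b) ` formal_sums"
        by (rule image_eqI)
      moreover have "0 \<in> (\<lambda>M. \<Sum>(a, b)\<in>#M. f a b) ` formal_sums"
        by (rule image_eqI[OF _ empty_in_formal_sums]) simp
      ultimately show "carrier two_monoid \<subseteq> (\<lambda>M. \<Sum>(a, b)\<in>#M. f a b) ` formal_sums"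
        by (simp add: two_monoid_def)
    qed
    show "monoid.mult two_monoid = (+)"
      by (simp add: two_monoid_def)
    show "g (m + n) = g m + g n" for m n
      by (simp add: g_def idem)
  qed (simp_all add: f_def g_def)
qed

theorem corollary7p12:
  assumes "geometric_lattice TYPE('a::complete_lattice)"
    and "nontrivial_lattice TYPE('a)"
    and "simple_lattice TYPE('a)"
  shows "(modular_lattice TYPE('a) \<and> Dim TYPE('a) \<cong> nat_monoid \<or>
          \<not> modular_lattice TYPE('a) \<and> Dim TYPE('a) \<cong> two_monoid) \<and>
         \<not> ((modular_lattice TYPE('a) \<and> Dim TYPE('a) \<cong> nat_monoid) \<and>
            (\<not> modular_lattice TYPE('a) \<and> Dim TYPE('a) \<cong> two_monoid))"
  using Dim_iso_nat[OF assms(1,3)] Dim_iso_two[OF assms(1,3)] by blast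

end
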